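(* Let $\ell:\mathbb{R}^r\to\mathbb{R}$ be twice differentiable (the loss as a function of the vector of basis singular values), and assume that its Hessian $\nabla^2\ell$ is $\rho$-Lipschitz: $$\|\nabla^2\ell(\mathbf{x})-\nabla^2\ell(\mathbf{y})\|_2\le\rho\,\|\mathbf{x}-\mathbf{y}\|_2\quad\text{for all }\mathbf{x},\mathbf{y}\in\mathbb{R}^r.$$ Let $\mathbf{s}=(s_1,\dots,s_r)\in\mathbb{R}^r$ be the vector of singular values and $i\in\{1,\dots,r\}$. Then the change in loss $\Delta\ell:=\ell(\mathbf{s}-s_i\mathbf{e}_i)-\ell(\mathbf{s})$ caused by pruning basis $i$ (replacing $s_i$ by $0$) satisfies $$|\Delta\ell|=\big|\ell(\mathbf{s}-s_i\mathbf{e}_i)-\ell(\mathbf{s})\big|\le\left|-g_is_i+\tfrac12H_{ii}s_i^2\right|+\frac{\rho}{6}|s_i|^3,$$ where $g_i:=\nabla\ell(\mathbf{s})^\top\mathbf{e}_i$ and $H_{ii}:=\mathbf{e}_i^\top\nabla^2\ell(\mathbf{s})\,\mathbf{e}_i$.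
   Context: $\mathbf{e}_i\in\mathbb{R}^r$ is the $i$-th standard basis vector. For matrices $\|\cdot\|_2$ is the operator (spectral) norm; for vectors it is the Euclidean norm. *)

theory Defs
  imports "HOL-Analysis.Analysis"
begin

definition grad :: "('a::real_inner \<Rightarrow> real) \<Rightarrow> 'a \<Rightarrow> 'a"
  where "grad f x = (THE D. GDERIV f x :> D)"

(* Entry (i, j) is the j-th partial derivative of the i-th component of the gradient.
   Meaningful only where grad f is differentiable; see twice_differentiable. *)
definition hessian :: "(real ^ 'n \<Rightarrow> real) \<Rightarrow> real ^ 'n \<Rightarrow> real ^ 'n ^ 'n"
  where "hessian f x = jacobian (grad f) (at x)"

definition twice_differentiable :: "(real ^ 'n \<Rightarrow> real) \<Rightarrow> bool"
  where "twice_differentiable f \<longleftrightarrow>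
    (\<forall>x. f differentiable at x) \<and> (\<forall>x. grad f differentiable at x)"

(* The type-class norm on real ^ 'n ^ 'm is the Frobenius norm, hence this separate definition
   of the operator norm with respect to the Euclidean vector norms. *)
definition spectral_norm :: "real ^ 'n ^ 'm \<Rightarrow> real"
  where "spectral_norm A = onorm ((*v) A)"

lemma GDERIV_unique:
  assumes "GDERIV f x :> D" "GDERIV f x :> E"
  shows "D = E"
proof -
  have "(\<lambda>h. inner h D) = (\<lambda>h. inner h E)"
    using assms has_derivative_unique unfolding gderiv_def by blast
  then have "inner (D - E) D = inner (D - E) E"
    by metis
  then have "inner (D - E) (D - E) = 0"
    by (simp add: inner_diff_right)
  then show ?thesis by simp
qed

lemma grad_eqI: "GDERIV f x :> D \<Longrightarrow> grad f x = D"
  unfolding grad_def by (blast intro: GDERIV_unique)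

lemma differentiable_imp_GDERIV_grad:
  fixes f :: "'a::euclidean_space \<Rightarrow> real"
  assumes "f differentiable at x"
  shows "GDERIV f x :> grad f x"
proof -
  obtain f' where f': "(f has_derivative f') (at x)"
    using assms by (auto simp: differentiable_def)
  have "f' = (\<lambda>h. inner h (adjoint f' 1))"
    using adjoint_works[OF has_derivative_linear[OF f']] by (auto simp: fun_eq_iff)
  then have "GDERIV f x :> adjoint f' 1"
    using f' unfolding gderiv_def by simp
  then show ?thesis by (simp add: grad_eqI)
qed

lemma twice_differentiable_hessian:
  assumes "twice_differentiable f"
  shows "(grad f has_derivative (\<lambda>h. hessian f x *v h)) (at x)"
  using assms unfolding twice_differentiable_def hessian_def
  by (metis jacobian_works)

end

theory Submission
  imports Defs
begin

text \<open>
  Along the segment from \<^term>\<open>x\<close> to \<^term>\<open>x + v\<close>, the loss is a function of one variable whose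
  second derivative at time \<^term>\<open>t\<close> differs from its value at 0 by at most
  \<^term>\<open>\<rho> * t * norm v ^ 3\<close>. Integrating this bound twice gives the cubic error term
  \<^term>\<open>\<rho> / 6 * norm v ^ 3\<close> of the second-order Taylor expansion, and pruning is the
  case \<^term>\<open>v = (- s $ i) *\<^sub>R axis i 1\<close>.
\<close>

text \<open>The difference \<open>g - f\<close> has a nonnegative derivative, so it is
  nondecreasing. This stands in for integrating \<open>f' \<le> g'\<close>, since the derivatives
  may fail to be integrable.\<close>

lemma DERIV_le_imp_diff_le:
  fixes f g :: "real \<Rightarrow> real"
  assumes "a \<le> b"
    and f: "\<And>t. a \<le> t \<Longrightarrow> t \<le> b \<Longrightarrow> (f has_real_derivative f' t) (at t)"
    and g: "\<And>t. a \<le> t \<Longrightarrow> t \<le> b \<Longrightarrow> (g has_real_derivative g' t) (at t)"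
    and le: "\<And>t. a \<le> t \<Longrightarrow> t \<le> b \<Longrightarrow> f' t \<le> g' t"
  shows "f b - f a \<le> g b - g a"
proof -
  have "\<exists>y. ((\<lambda>t. g t - f t) has_real_derivative y) (at t) \<and> 0 \<le> y" if "a \<le> t" "t \<le> b" for t
    using DERIV_diff[OF g f] le that by (metis diff_ge_0_iff_ge)
  then have "g a - f a \<le> g b - f b"
    using DERIV_nonneg_imp_nondecreasing[OF \<open>a \<le> b\<close>, of "\<lambda>t. g t - f t"] by blast
  then show ?thesis by simp
qed

lemma taylor2_upper_bound:
  fixes f :: "real \<Rightarrow> real"
  assumes f: "\<And>t. (f has_real_derivative f' t) (at t)"
    and f': "\<And>t. (f' has_real_derivative f'' t) (at t)"
    and le: "\<And>t. 0 \<le> t \<Longrightarrow> t \<le> 1 \<Longrightarrow> f'' t \<le> f'' 0 + M * t"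
  shows "f 1 - f 0 \<le> f' 0 + f'' 0 / 2 + M / 6"
proof -
  have "f' t \<le> f' 0 + f'' 0 * t + M * t\<^sup>2 / 2" if t: "0 \<le> t" "t \<le> 1" for t
  proof -
    \<comment> \<open>First integration: this antiderivative of the bound on \<open>f''\<close>
      vanishes at 0 and is compared with \<open>f'\<close> on \<open>[0, t]\<close>.\<close>
    have "((\<lambda>u. f'' 0 * u + M * u\<^sup>2 / 2) has_real_derivative f'' 0 + M * u) (at u)" for u
      by (auto intro!: derivative_eq_intros)
    from DERIV_le_imp_diff_le[OF t(1) f' this] le t show ?thesis
      by auto
  qed
  \<comment> \<open>Second integration, now of the bound on \<open>f'\<close>; evaluating at 1
    produces the constants 1/2 and 1/6.\<close>
  moreover have "((\<lambda>u. f' 0 * u + f'' 0 * u\<^sup>2 / 2 + M * u ^ 3 / 6)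
      has_real_derivative f' 0 + f'' 0 * u + M * u\<^sup>2 / 2) (at u)" for u
    by (auto intro!: derivative_eq_intros)
  ultimately show ?thesis
    using DERIV_le_imp_diff_le[OF zero_le_one f, of "\<lambda>u. f' 0 * u + f'' 0 * u\<^sup>2 / 2 + M * u ^ 3 / 6"]
    by fastforce
qed

text \<open>The hypothesis is symmetric under negation, so the one-sided bound applies to both
  \<open>f\<close> and \<open>- f\<close>.\<close>

lemma taylor2_error_bound:
  fixes f :: "real \<Rightarrow> real"
  assumes f: "\<And>t. (f has_real_derivative f' t) (at t)"
    and f': "\<And>t. (f' has_real_derivative f'' t) (at t)"
    and le: "\<And>t. 0 \<le> t \<Longrightarrow> t \<le> 1 \<Longrightarrow> \<bar>f'' t - f'' 0\<bar> \<le> M * t"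
  shows "\<bar>f 1 - f 0 - (f' 0 + f'' 0 / 2)\<bar> \<le> M / 6"
proof -
  have "f 1 - f 0 \<le> f' 0 + f'' 0 / 2 + M / 6"
    using le by (intro taylor2_upper_bound[OF f f']) (force simp: abs_le_iff)
  moreover have "- f 1 - - f 0 \<le> - f' 0 + - f'' 0 / 2 + M / 6"
    using le by (intro taylor2_upper_bound[OF DERIV_minus[OF f] DERIV_minus[OF f']])
      (force simp: abs_le_iff)
  ultimately show ?thesis by linarith
qed

text \<open>Cauchy-Schwarz gives one factor \<open>norm v\<close>, the operator norm bound on
  \<open>A *v v\<close> the other.\<close>

lemma abs_quadratic_form_le_spectral_norm:
  fixes A :: "real ^ 'n ^ 'n"
  shows "\<bar>v \<bullet> (A *v v)\<bar> \<le> spectral_norm A * (norm v)\<^sup>2"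
proof -
  have "norm (A *v v) \<le> spectral_norm A * norm v"
    unfolding spectral_norm_def by (rule onorm) simp
  then have "norm v * norm (A *v v) \<le> norm v * (spectral_norm A * norm v)"
    by (rule mult_left_mono) simp
  with Cauchy_Schwarz_ineq2[of v "A *v v"] show ?thesis
    by (simp add: power2_eq_square mult_ac)
qed

lemma taylor2_lipschitz_hessian:
  fixes l :: "real ^ 'n \<Rightarrow> real"
  assumes l: "twice_differentiable l"
    and lip: "\<And>x y. spectral_norm (hessian l x - hessian l y) \<le> \<rho> * norm (x - y)"
  shows "\<bar>l (x + v) - l x - (grad l x \<bullet> v + (v \<bullet> (hessian l x *v v)) / 2)\<bar> \<le> \<rho> / 6 * norm v ^ 3"
proof -
  define c where "c t = x + t *\<^sub>R v" for t :: real
  have c: "(c has_derivative (\<lambda>h. h *\<^sub>R v)) (at t)" for t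
    unfolding c_def by (auto intro!: derivative_eq_intros)
  have "((\<lambda>t. l (c t)) has_real_derivative grad l (c t) \<bullet> v) (at t)" for t
  proof -
    have "(l has_derivative (\<lambda>h. h \<bullet> grad l (c t))) (at (c t))"
      using l differentiable_imp_GDERIV_grad
      unfolding twice_differentiable_def gderiv_def by blast
    from has_derivative_compose[OF c this] show ?thesis
      by (simp add: has_field_derivative_def inner_commute mult.commute[of _ "v \<bullet> _"]
          mult_commute_abs)
  qed
  moreover have "((\<lambda>t. grad l (c t) \<bullet> v) has_real_derivative v \<bullet> (hessian l (c t) *v v)) (at t)" for t
  proof -
    have "((\<lambda>t. grad l (c t) \<bullet> v) has_derivative
        (\<lambda>h. (hessian l (c t) *v (h *\<^sub>R v)) \<bullet> v)) (at t)"
      by (intro has_derivative_inner_left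
          has_derivative_compose[OF c twice_differentiable_hessian[OF l]])
    then show ?thesis
      by (simp add: has_field_derivative_def inner_commute matrix_vector_mult_scaleR
          mult_commute_abs)
  qed
  \<comment> \<open>Of the three factors \<open>norm v\<close>, two come from the quadratic form and
    one from the distance \<open>norm (c t - c 0) = t * norm v\<close>.\<close>
  moreover have "\<bar>v \<bullet> (hessian l (c t) *v v) - v \<bullet> (hessian l (c 0) *v v)\<bar> \<le> \<rho> * norm v ^ 3 * t"
    if "0 \<le> t" for t
  proof -
    have "\<bar>v \<bullet> ((hessian l (c t) - hessian l (c 0)) *v v)\<bar>
        \<le> spectral_norm (hessian l (c t) - hessian l (c 0)) * (norm v)\<^sup>2"
      by (rule abs_quadratic_form_le_spectral_norm)
    also have "\<dots> \<le> \<rho> * norm (c t - c 0) * (norm v)\<^sup>2"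
      by (intro mult_right_mono lip) simp
    also have "\<dots> = \<rho> * norm v ^ 3 * t"
      using that by (simp add: c_def power2_eq_square power3_eq_cube)
    finally show ?thesis
      by (simp add: matrix_vector_mult_diff_rdistrib inner_diff_right)
  qed
  ultimately have "\<bar>l (c 1) - l (c 0) - (grad l (c 0) \<bullet> v + (v \<bullet> (hessian l (c 0) *v v)) / 2)\<bar>
      \<le> \<rho> * norm v ^ 3 / 6"
    by (rule taylor2_error_bound)
  then show ?thesis by (simp add: c_def)
qed

theorem theorem6:
  fixes l :: "real ^ 'r \<Rightarrow> real"
    and \<rho> :: real
    and s :: "real ^ 'r"
    and i :: 'r
  assumes "twice_differentiable l"
    and "\<forall>x y. spectral_norm (hessian l x - hessian l y) \<le> \<rho> * norm (x - y)"
  shows "\<bar>l (s - s $ i *\<^sub>R axis i 1) - l s\<bar>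
    \<le> \<bar>- (grad l s \<bullet> axis i 1) * s $ i
         + 1 / 2 * (axis i 1 \<bullet> (hessian l s *v axis i 1)) * (s $ i)\<^sup>2\<bar>
      + \<rho> / 6 * \<bar>s $ i\<bar> ^ 3"
proof -
  define e :: "real ^ 'r" where "e = axis i 1"
  define v where "v = (- s $ i) *\<^sub>R e"
  have v: "s + v = s - s $ i *\<^sub>R e" "norm v = \<bar>s $ i\<bar>"
    by (simp_all add: v_def e_def)
  \<comment> \<open>The minus sign in \<open>v\<close> survives in the linear term and squares away
    in the quadratic one.\<close>
  have "grad l s \<bullet> v + (v \<bullet> (hessian l s *v v)) / 2
      = - (grad l s \<bullet> e) * s $ i + 1 / 2 * (e \<bullet> (hessian l s *v e)) * (s $ i)\<^sup>2"
    unfolding v_def matrix_vector_mult_scaleR by (simp add: power2_eq_square)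
  \<comment> \<open>The triangle inequality splits the loss change into its quadratic model and the
    Taylor error.\<close>
  with taylor2_lipschitz_hessian[OF assms(1) assms(2)[rule_format], of s v]
  show ?thesis
    unfolding v e_def by linarith
qed

end
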